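(* Let $n\ge2$ be an integer, and let $f:\mathbb N\setminus\{0\}\to\mathbb Q$, $f(i)=\delta_{i,\lfloor i/2\rfloor;0,0}$. Then - $f(1)=1$, - $f$ is (weakly) increasing, and - $\lim_{i\to+\infty}f(i)=+\infty$. Moreover, if $i,p,j,q\in\mathbb N$ satisfy $p\le\lfloor i/2\rfloor$, $q\le\lfloor j/2\rfloor$, $i>j$ and $0\le p-q\le i-j$, then $$\delta_{i,p;j,q}\ge f(i).$$
   Context: For a real number $\delta$ and $i,p\in\mathbb N$ put $\gamma_{i,p}=n(n+1)\delta(\delta-1)-2((n+1)\delta-n+p)i+2i^2+2p(p-1)$. For $i,p,j,q\in\mathbb N$ with $p\le\lfloor i/2\rfloor$, $q\le\lfloor j/2\rfloor$ and $i>j$, $\delta_{i,p;j,q}$ denotes the unique value of $\delta$ for which $\gamma_{i,p}=\gamma_{j,q}$. *)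

theory Defs
  imports Complex_Main
begin

definition gam :: "nat \<Rightarrow> real \<Rightarrow> nat \<Rightarrow> nat \<Rightarrow> real" where
  "gam n \<delta> i p =
     real n * (real n + 1) * \<delta> * (\<delta> - 1)
     - 2 * ((real n + 1) * \<delta> - real n + real p) * real i
     + 2 * (real i)\<^sup>2 + 2 * real p * (real p - 1)"

text \<open>
  The terms of \<open>gam\<close> quadratic in \<open>\<delta>\<close> do not depend on \<open>i\<close> and \<open>p\<close>, so for \<open>i > j\<close> the equation
  below is linear in \<open>\<delta>\<close> and the description is proper (lemma \<open>ex1_delta\<close>). For \<open>i = j\<close> the value
  is unspecified.
\<close>

definition delta :: "nat \<Rightarrow> nat \<Rightarrow> nat \<Rightarrow> nat \<Rightarrow> nat \<Rightarrow> real" where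
  "delta n i p j q = (THE \<delta>. gam n \<delta> i p = gam n \<delta> j q)"

lemma ex1_delta:
  assumes "j < i"
  shows "\<exists>!\<delta>. gam n \<delta> i p = gam n \<delta> j q"
proof -
  define a where "a = 2 * (real n + 1) * (real i - real j)"
  define b where "b = gam n 0 i p - gam n 0 j q"
  have a: "a \<noteq> 0"
    using assms by (simp add: a_def)
  have "gam n \<delta> i p - gam n \<delta> j q = b - a * \<delta>" for \<delta>
    by (simp add: gam_def a_def b_def algebra_simps)
  then have "gam n \<delta> i p = gam n \<delta> j q \<longleftrightarrow> \<delta> = b / a" for \<delta>
    using a by (metis eq_iff_diff_eq_0 mult.commute nonzero_eq_divide_eq)
  then show ?thesis
    by simp
qed

end

theory Submission
  imports Defs
begin

text \<open>
  The equation \<open>gam n \<delta> i p = gam n \<delta> j q\<close> is linear in \<open>\<delta>\<close>, and its solution is, up to the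
  factor \<open>n + 1\<close>, the slope of the chord between the points \<open>(j, height n j q)\<close> and
  \<open>(i, height n i p)\<close>, where \<open>height n i p = i\<^sup>2 + n i - p i + p\<^sup>2 - p\<close>. In particular
  \<open>(n + 1) f(i)\<close> is the slope of the chord from the origin to \<open>(i, height n i \<lfloor>i/2\<rfloor>)\<close>, the lowest
  admissible point above \<open>i\<close>, as the height is decreasing in \<open>p\<close> for \<open>p \<le> i/2\<close>.

  The inequality \<open>\<delta>\<^bsub>i,p;j,q\<^esub> \<ge> f(i)\<close> splits according to \<open>d = i - j\<close> and \<open>P = \<lfloor>i/2\<rfloor>\<close>.
  If \<open>d > P\<close>, the point above \<open>j\<close> has slope at most \<open>n + j\<close> from the origin, which is below
  \<open>(n + 1) f(i)\<close>, so the point lies under the chord to \<open>i\<close> and the chord from it is steeper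
  (lemma \<open>chord_bound_far\<close>). If \<open>d \<le> P\<close>, monotonicity in \<open>p\<close> and \<open>q\<close> reduces to the case
  \<open>p - q = d\<close>, where the slope is \<open>n + i + q - 1\<close>; this dominates \<open>(n + 1) f(i) \<le> n + i - 1\<close>
  (lemma \<open>chord_bound_near\<close>).

  Monotonicity of \<open>f\<close> is a consequence of that inequality: it says that the chord from \<open>j\<close> to \<open>i\<close>
  is at least as steep as the chord from the origin to \<open>i\<close>, hence the chord from the origin to
  \<open>j\<close> is at most as steep. Divergence holds because \<open>(n + 1) f(i) \<ge> n + i/2\<close>.
\<close>

definition height :: "nat \<Rightarrow> nat \<Rightarrow> nat \<Rightarrow> real" where
  "height n i p = (real i)\<^sup>2 + real n * real i - real p * real i + (real p)\<^sup>2 - real p"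

lemma height_0_0 [simp]: "height n 0 0 = 0"
  by (simp add: height_def)

lemma delta_eq_slope:
  assumes "j < i"
  shows "delta n i p j q
    = (height n i p - height n j q) / ((real n + 1) * (real i - real j))"
proof -
  let ?s = "(height n i p - height n j q) / ((real n + 1) * (real i - real j))"
  have "(real n + 1) * (real i - real j) \<noteq> 0"
    using assms by simp
  then have "?s * ((real n + 1) * (real i - real j)) = height n i p - height n j q"
    by simp
  moreover have "gam n x i p - gam n x j q
    = 2 * (height n i p - height n j q - x * ((real n + 1) * (real i - real j)))" for x
    by (simp add: gam_def height_def algebra_simps power2_eq_square)
  ultimately have "gam n ?s i p = gam n ?s j q"
    by (metis cancel_comm_monoid_add_class.diff_cancel eq_iff_diff_eq_0 mult_zero_right)
  then show ?thesis
    unfolding delta_def using ex1_delta[OF assms] by (intro the1_equality)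
qed

lemma height_antimono:
  assumes "p \<le> p'" "p' \<le> i div 2"
  shows "height n i p' \<le> height n i p"
proof -
  have "real p + real p' \<le> real i"
    using assms by linarith
  then have "0 \<le> (real p' - real p) * (real i + 1 - real p - real p')"
    using assms by (intro mult_nonneg_nonneg) auto
  also have "\<dots> = height n i p - height n i p'"
    by (simp add: height_def algebra_simps power2_eq_square)
  finally show ?thesis by simp
qed

lemma nat_mult_pred_nonneg: "0 \<le> real k * (real k - 1)"
  by (cases k) auto

lemma height_ge:
  assumes "p \<le> i"
  shows "real i * (real n + real i - real p) \<le> height n i p"
  using nat_mult_pred_nonneg[of p] by (simp add: height_def algebra_simps power2_eq_square)

text \<open>
  The height is \<open>i (n + i - 1)\<close> at \<open>p = 1\<close> already, and it does not increase from there up to \<open>p = \<lfloor>i/2\<rfloor>\<close>.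
\<close>

lemma height_half_le:
  assumes "1 \<le> i div 2"
  shows "height n i (i div 2) \<le> real i * (real n + real i - 1)"
  using height_antimono[OF assms order_refl, of n]
  by (simp add: height_def algebra_simps power2_eq_square)

lemma chord_bound_far:
  assumes "p \<le> i div 2" "q \<le> j div 2" "j < i" "i div 2 < i - j"
  shows "(real i - real j) * height n i (i div 2) \<le> real i * (height n i p - height n j q)"
proof -
  let ?H = "height n i (i div 2)"
  have "height n j q \<le> height n j 0"
    using assms by (intro height_antimono) auto
  then have "real i * height n j q \<le> real i * (real j * (real n + real j))"
    by (intro mult_left_mono) (simp_all add: height_def algebra_simps power2_eq_square)
  also have "\<dots> \<le> real j * (real i * (real n + real i - real (i div 2)))"
  proof -
    have "real j \<le> real i - real (i div 2)"
      using assms by linarith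
    then have "real j * (real i * (real n + real j))
      \<le> real j * (real i * (real n + real i - real (i div 2)))"
      by (intro mult_left_mono) auto
    then show ?thesis by (simp add: mult.left_commute)
  qed
  also have "\<dots> \<le> real j * ?H"
    by (intro mult_left_mono height_ge) auto
  finally have "real i * height n j q \<le> real j * ?H" .
  moreover have "real i * ?H \<le> real i * height n i p"
    using assms by (intro mult_left_mono height_antimono) auto
  ultimately show ?thesis
    by (simp add: algebra_simps)
qed

lemma chord_bound_near:
  assumes "p \<le> i div 2" "q \<le> j div 2" "j < i" "p \<le> q + (i - j)" "i - j \<le> i div 2"
  shows "(real i - real j) * height n i (i div 2) \<le> real i * (height n i p - height n j q)"
proof -
  \<comment> \<open>Raising \<open>p\<close> to at least \<open>i - j\<close> lowers the upper point; then lowering \<open>q\<close> to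
    \<open>p - (i - j)\<close> raises the lower one.\<close>
  define p' where "p' = max p (i - j)"
  define q' where "q' = p' - (i - j)"
  have "height n i p' \<le> height n i p"
    using assms unfolding p'_def by (intro height_antimono) auto
  moreover have "height n j q \<le> height n j q'"
    using assms unfolding p'_def q'_def by (intro height_antimono) auto
  moreover have "height n i p' - height n j q'
    = (real i - real j) * (real n + real i - 1 + real q')"
  proof -
    have p'_eq: "real p' = real q' + real i - real j"
      using assms unfolding q'_def p'_def by linarith
    show ?thesis
      unfolding height_def p'_eq by (simp add: algebra_simps power2_eq_square)
  qed
  moreover have "(real i - real j) * (real n + real i - 1)
      \<le> (real i - real j) * (real n + real i - 1 + real q')"
    using assms by (intro mult_left_mono) auto
  ultimately have
    "(real i - real j) * (real n + real i - 1) \<le> height n i p - height n j q"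
    by linarith
  then have "real i * ((real i - real j) * (real n + real i - 1))
      \<le> real i * (height n i p - height n j q)"
    by (intro mult_left_mono) auto
  moreover have "(real i - real j) * height n i (i div 2)
      \<le> (real i - real j) * (real i * (real n + real i - 1))"
    using assms by (intro mult_left_mono height_half_le) auto
  ultimately show ?thesis
    by (simp add: mult.left_commute)
qed

lemma delta_from_origin_le:
  assumes "p \<le> i div 2" "q \<le> j div 2" "j < i" "p \<le> q + (i - j)"
  shows "delta n i (i div 2) 0 0 \<le> delta n i p j q"
proof -
  have "(real i - real j) * height n i (i div 2) \<le> real i * (height n i p - height n j q)"
    using chord_bound_far chord_bound_near assms not_le by metis
  then have "height n i (i div 2) / real i
      \<le> (height n i p - height n j q) / (real i - real j)"
    using assms by (simp add: field_simps)
  then have "height n i (i div 2) / real i / (real n + 1)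
      \<le> (height n i p - height n j q) / (real i - real j) / (real n + 1)"
    by (intro divide_right_mono) auto
  then show ?thesis
    using assms by (simp add: delta_eq_slope mult.commute)
qed

text \<open>
  In the triangle formed by the origin and the lowest points above \<open>j\<close> and \<open>i\<close>, the side from \<open>j\<close>
  to \<open>i\<close> is at least as steep as the side from the origin to \<open>i\<close>, so the remaining side is at most
  as steep.
\<close>

lemma delta_from_origin_mono:
  assumes "1 \<le> j" "j \<le> i"
  shows "delta n j (j div 2) 0 0 \<le> delta n i (i div 2) 0 0"
proof (cases "j = i")
  case False
  then have "j < i" using assms by simp
  then have "delta n i (i div 2) 0 0 \<le> delta n i (i div 2) j (j div 2)"
    by (intro delta_from_origin_le) auto
  then have "height n i (i div 2) / real i / (real n + 1)
      \<le> (height n i (i div 2) - height n j (j div 2)) / (real i - real j) / (real n + 1)"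
    using \<open>j < i\<close> by (simp add: delta_eq_slope mult.commute)
  then have "height n i (i div 2) / real i
      \<le> (height n i (i div 2) - height n j (j div 2)) / (real i - real j)"
    by (simp add: divide_le_cancel del: divide_divide_eq_left)
  then have "height n j (j div 2) / real j \<le> height n i (i div 2) / real i"
    using \<open>j < i\<close> \<open>1 \<le> j\<close> by (simp add: field_simps)
  then have "height n j (j div 2) / real j / (real n + 1)
      \<le> height n i (i div 2) / real i / (real n + 1)"
    by (intro divide_right_mono) auto
  then show ?thesis
    using \<open>j < i\<close> \<open>1 \<le> j\<close> by (simp add: delta_eq_slope mult.commute)
qed simp

lemma delta_from_origin_ge:
  assumes "1 \<le> i"
  shows "real i / (2 * (real n + 1)) \<le> delta n i (i div 2) 0 0"
proof -
  have "real i / 2 \<le> real n + real i - real (i div 2)"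
    by linarith
  then have "real i * (real i / 2) \<le> real i * (real n + real i - real (i div 2))"
    by (intro mult_left_mono) auto
  also have "\<dots> \<le> height n i (i div 2)"
    by (intro height_ge) auto
  finally have "real i / 2 \<le> height n i (i div 2) / real i"
    using assms by (simp add: field_simps)
  then have "real i / 2 / (real n + 1) \<le> height n i (i div 2) / real i / (real n + 1)"
    by (intro divide_right_mono) auto
  then show ?thesis
    using assms by (simp add: delta_eq_slope mult.commute)
qed

theorem proposition7:
  fixes n :: nat and f :: "nat \<Rightarrow> real"
  assumes "n \<ge> 2"
    and "\<And>i. i \<ge> 1 \<Longrightarrow> f i = delta n i (i div 2) 0 0"
  shows "(\<forall>i\<ge>1. f i \<in> \<rat>)
    \<and> f 1 = 1
    \<and> mono_on {1..} f
    \<and> filterlim f at_top sequentially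
    \<and> (\<forall>i p j q :: nat. p \<le> i div 2 \<longrightarrow> q \<le> j div 2 \<longrightarrow> i > j
         \<longrightarrow> 0 \<le> int p - int q \<longrightarrow> int p - int q \<le> int i - int j
         \<longrightarrow> delta n i p j q \<ge> f i)"
proof (intro conjI allI impI)
  fix i :: nat
  assume "1 \<le> i"
  then show "f i \<in> \<rat>"
    using assms(2) by (simp add: delta_eq_slope height_def)
next
  show "f 1 = 1"
    using assms(2) by (simp add: delta_eq_slope height_def)
next
  show "mono_on {1..} f"
    using assms(2) by (auto intro!: mono_onI delta_from_origin_mono)
next
  have "filterlim (\<lambda>i. 1 / (2 * (real n + 1)) * real i) at_top sequentially"
    by (intro filterlim_tendsto_pos_mult_at_top[OF tendsto_const] filterlim_real_sequentially) auto
  moreover have "\<forall>\<^sub>F i in sequentially. 1 / (2 * (real n + 1)) * real i \<le> f i"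
    using eventually_ge_at_top[of 1]
    by eventually_elim (use assms(2) delta_from_origin_ge in simp)
  ultimately show "filterlim f at_top sequentially"
    by (rule filterlim_at_top_mono)
next
  fix i p j q :: nat
  assume *: "p \<le> i div 2" "q \<le> j div 2" "j < i" "int p - int q \<le> int i - int j"
  then have "p \<le> q + (i - j)" by linarith
  then show "f i \<le> delta n i p j q"
    using * assms(2) delta_from_origin_le by simp
qed

end
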